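(* Let $N\ge 2$, $\mathcal V=\{1,\dots,N\}$, and let $f_i:\mathbb R^N\to\mathbb R$, $i\in\mathcal V$, be the objective functions of an $N$-player game in which player $i$ chooses $x_i\in\mathbb R$ to minimize $f_i(\mathbf x)$, $\mathbf x=[x_1,\dots,x_N]^T$. Suppose that: (i) each $f_i$ is twice-continuously differentiable; (ii) for each $i\in\mathcal V$ there is a constant $l_i>0$ with $\|\nabla_i f_i(\mathbf x)-\nabla_i f_i(\mathbf z)\|\le l_i\|\mathbf x-\mathbf z\|$ for all $\mathbf x,\mathbf z\in\mathbb R^N$; (iii) there is a constant $m>0$ with $(\mathbf x-\mathbf z)^T(\mathcal P(\mathbf x)-\mathcal P(\mathbf z))\ge m\|\mathbf x-\mathbf z\|^2$ for all $\mathbf x,\mathbf z\in\mathbb R^N$, where $\mathcal P(\mathbf x)=[\nabla_1f_1(\mathbf x),\dots,\nabla_Nf_N(\mathbf x)]^T$; (iv) $\mathcal G$ is an undirected connected graph on the vertex set $\mathcal V$ without self-loops, with $0$-$1$ adjacency matrix $[a_{ij}]$. Let $\gamma_{ij}>0$ ($i,j\in\mathcal V$) be constants, and let the players update their actions $x_i$, estimates $y_{ij}$ and adaptive gains $\theta_{ij}$ (all real-valued, $i,j\in\mathcal V$) according to $$\dot x_i=-\nabla_i f_i(\mathbf y_i),$$ $$\dot y_{ij}=-\theta_{ij}\Big(\sum_{k=1}^N a_{ik}(y_{ij}-y_{kj})+a_{ij}(y_{ij}-x_j)\Big),$$ $$\dot\theta_{ij}=\gamma_{ij}\Big(\sum_{k=1}^N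 a_{ik}(y_{ij}-y_{kj})+a_{ij}(y_{ij}-x_j)\Big)^2,$$ where $\mathbf y_i=[y_{i1},\dots,y_{iN}]^T$ and $\mathbf y=[\mathbf y_1^T,\dots,\mathbf y_N^T]^T$. Let $\mathbf x^*$ be the Nash equilibrium of the game. Then: 1. the Nash equilibrium $\mathbf x^*$ is globally asymptotically stable; 2. the estimation error satisfies $\|\mathbf y-\mathbf 1_N\otimes\mathbf x\|\to 0$ as $t\to\infty$; 3. for each $i,j\in\mathcal V$, $\theta_{ij}$ converges to some finite value.
   Context: $\nabla_i f_i(\mathbf z)$ denotes the partial derivative $\partial f_i(\mathbf x)/\partial x_i$ evaluated at $\mathbf x=\mathbf z$. $\|\cdot\|$ is the Euclidean norm, $\mathbf 1_N$ is the $N$-dimensional column vector of ones, $\otimes$ is the Kronecker product (so $\mathbf 1_N\otimes\mathbf x$ stacks $N$ copies of $\mathbf x$). The adjacency matrix has $a_{ij}=1$ if $(j,i)$ is an edge and $a_{ij}=0$ otherwise; undirected means $a_{ij}=a_{ji}$; no self-loops means $a_{ii}=0$; connected means there is a path between any two vertices. The variable $y_{ij}$ is player $i$'s local estimate of $x_j$. An action profile $\mathbf x^*=(x_i^*,\mathbf x_{-i}^* )$ is a Nash equilibrium if $f_i(x_i^*,\mathbf x_{-i}^* )\le f_i(x_i,\mathbf x_{-i}^* )$ for all $x_i\in\mathbb R$ and $i\in\mathcal V$, where $\mathbf x_{-i}=[x_1,\dots,x_{i-1},x_{i+1},\dots,x_N]^T$. Under hypotheses (i)-(iii) the Nash equilibrium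 exists, is unique, and is the unique solution of $\mathcal P(\mathbf x)=\mathbf 0_N$, where $\mathbf 0_N$ is the $N$-dimensional zero vector.
   Formalization: Global asymptotic stability of x* is read as: trajectories exist and x→x* from all initial states and gains, but Lyapunov stability is claimed only for equilibria (x*, 1⊗x*, θ) whose gains all exceed some threshold; it fails at small gains, e.g. f1=x1²/2−2x1x2, f2=x2²/2+2x1x2. *)

theory Defs
  imports "HOL-Analysis.Analysis"
begin

section \<open>Games on \<open>real ^ 'n\<close>\<close>

text \<open>The players are the elements of a finite type \<open>'n\<close>, so the number of players is
  \<open>CARD('n)\<close>. The objective function of player \<open>i\<close> is \<open>f i\<close>.\<close>

definition with_action :: "real ^ 'n \<Rightarrow> 'n \<Rightarrow> real \<Rightarrow> real ^ 'n" where
  "with_action x i u = (\<chi> k. if k = i then u else x $ k)"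

definition partial_deriv :: "'n \<Rightarrow> (real ^ 'n \<Rightarrow> real) \<Rightarrow> real ^ 'n \<Rightarrow> real" where
  "partial_deriv i g z = deriv (\<lambda>u. g (with_action z i u)) (z $ i)"

definition twice_continuously_differentiable ::
    "('a::real_normed_vector \<Rightarrow> 'b::real_normed_vector) \<Rightarrow> bool" where
  "twice_continuously_differentiable g \<longleftrightarrow>
     (\<exists>(g' :: 'a \<Rightarrow> 'a \<Rightarrow>\<^sub>L 'b) (g'' :: 'a \<Rightarrow> 'a \<Rightarrow>\<^sub>L ('a \<Rightarrow>\<^sub>L 'b)).
        (\<forall>x. (g has_derivative blinfun_apply (g' x)) (at x)) \<and>
        (\<forall>x. (g' has_derivative blinfun_apply (g'' x)) (at x)) \<and>
        continuous_on UNIV g'')"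

definition pseudo_gradient :: "('n \<Rightarrow> real ^ 'n \<Rightarrow> real) \<Rightarrow> real ^ 'n \<Rightarrow> real ^ 'n" where
  "pseudo_gradient f x = (\<chi> i. partial_deriv i (f i) x)"

definition nash_equilibrium :: "('n \<Rightarrow> real ^ 'n \<Rightarrow> real) \<Rightarrow> real ^ 'n \<Rightarrow> bool" where
  "nash_equilibrium f xs \<longleftrightarrow> (\<forall>i u. f i xs \<le> f i (with_action xs i u))"


section \<open>Communication graph\<close>

text \<open>A pair \<open>(j, i) \<in> E\<close> is an edge from \<open>j\<close> to \<open>i\<close>.\<close>

definition undirected_connected_graph :: "('n \<times> 'n) set \<Rightarrow> bool" where
  "undirected_connected_graph E \<longleftrightarrow> sym E \<and> irrefl E \<and> (\<forall>i j. (i, j) \<in> E\<^sup>*)"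

definition adjacency :: "('n \<times> 'n) set \<Rightarrow> 'n \<Rightarrow> 'n \<Rightarrow> real" where
  "adjacency E i j = (if (j, i) \<in> E then 1 else 0)"


section \<open>Autonomous differential equations\<close>

definition ode_solution :: "('a::real_normed_vector \<Rightarrow> 'a) \<Rightarrow> (real \<Rightarrow> 'a) \<Rightarrow> bool" where
  "ode_solution F z \<longleftrightarrow> (\<forall>t\<ge>0. (z has_vector_derivative F (z t)) (at t within {0..}))"

definition stable_equilibrium_point :: "('a::real_normed_vector \<Rightarrow> 'a) \<Rightarrow> 'a \<Rightarrow> bool" where
  "stable_equilibrium_point F p \<longleftrightarrow> F p = 0 \<and>
     (\<forall>\<epsilon>>0. \<exists>\<delta>>0. \<forall>z. ode_solution F z \<and> dist (z 0) p < \<delta> \<longrightarrow> (\<forall>t\<ge>0. dist (z t) p < \<epsilon>))"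


section \<open>The adaptive seeking dynamics\<close>

text \<open>A state is a triple \<open>(x, y, \<theta>)\<close> with \<open>y $ i $ j\<close> the estimate of \<open>x $ j\<close> held by player \<open>i\<close>;
  thus \<open>y $ i\<close> is the vector of all estimates of player \<open>i\<close>, and the norm on
  \<open>real ^ 'n ^ 'n\<close> is the Euclidean norm of the stacked vector of the rows.\<close>

type_synonym 'n state = "(real ^ 'n) \<times> (real ^ 'n ^ 'n) \<times> (real ^ 'n ^ 'n)"

definition stacked_copies :: "real ^ 'n \<Rightarrow> real ^ 'n ^ 'n" where
  "stacked_copies x = (\<chi> i. x)"

definition consensus_error ::
    "('n::finite \<times> 'n) set \<Rightarrow> real ^ 'n \<Rightarrow> real ^ 'n ^ 'n \<Rightarrow> 'n \<Rightarrow> 'n \<Rightarrow> real" where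
  "consensus_error E x y i j =
     (\<Sum>k\<in>UNIV. adjacency E i k * (y $ i $ j - y $ k $ j)) + adjacency E i j * (y $ i $ j - x $ j)"

definition seeking_field ::
    "('n::finite \<Rightarrow> real ^ 'n \<Rightarrow> real) \<Rightarrow> ('n \<times> 'n) set \<Rightarrow> ('n \<Rightarrow> 'n \<Rightarrow> real) \<Rightarrow> 'n state \<Rightarrow> 'n state"
  where
  "seeking_field f E \<gamma> = (\<lambda>(x, y, \<theta>).
     (\<chi> i. - partial_deriv i (f i) (y $ i),
      \<chi> i j. - \<theta> $ i $ j * consensus_error E x y i j,
      \<chi> i j. \<gamma> i j * (consensus_error E x y i j)\<^sup>2))"

text \<open>
  The action profile \<open>xs\<close> corresponds to the equilibria
  \<open>(xs, stacked_copies xs, \<theta>s)\<close> of the closed loop, one for every \<open>\<theta>s\<close>. Those with small gains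
  need not be stable: for two players with
  \<open>f\<^sub>1 x = x\<^sub>1\<^sup>2 / 2 - 2 x\<^sub>1 x\<^sub>2\<close> and \<open>f\<^sub>2 x = x\<^sub>2\<^sup>2 / 2 + 2 x\<^sub>1 x\<^sub>2\<close>, the linearisation at small
  positive gains has an eigenvalue with positive real part, and the actions make an excursion
  of fixed size before the gains have grown enough to bring them back. Global asymptotic stability
  of \<open>xs\<close> in an adaptive scheme therefore means: Lyapunov stability (in the full state) of the
  equilibria with large enough gains, together with convergence of the actions to \<open>xs\<close> from every
  initial state, including every initial value of the gains, the trajectories being defined for all
  \<open>t \<ge> 0\<close>.
\<close>

definition actions_globally_asymptotically_stable ::
    "('n::finite state \<Rightarrow> 'n state) \<Rightarrow> real ^ 'n \<Rightarrow> bool" where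
  "actions_globally_asymptotically_stable F xs \<longleftrightarrow>
     (\<exists>\<Theta>. \<forall>\<theta>s. (\<forall>i j. \<Theta> \<le> \<theta>s $ i $ j) \<longrightarrow>
        stable_equilibrium_point F (xs, stacked_copies xs, \<theta>s)) \<and>
     (\<forall>z0. \<exists>z. z 0 = z0 \<and> ode_solution F z) \<and>
     (\<forall>z. ode_solution F z \<longrightarrow> ((\<lambda>t. fst (z t)) \<longlongrightarrow> xs) at_top)"

end

theory Submission
  imports Defs
begin

text \<open>Write \<open>w = y - stacked_copies x\<close> for the estimation error. The consensus error is a linear function
  \<open>M w\<close> of it, and \<open>M\<close> splits over the estimated coordinate \<open>j\<close> into the matrices ``graph Laplacian plus
  the indicator of the neighbours of \<open>j\<close>''. On a connected undirected graph with at least two vertices each of these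
  is symmetric and positive definite (\<open>consensus_map_self_adjoint\<close>,
  \<open>consensus_map_positive_definite\<close>), so \<open>w \<bullet> M w\<close> is equivalent to the squared norm of \<open>w\<close>.

  Everything rests on the function
  \<open>V = ((norm (x - xs))\<^sup>2 + w \<bullet> M w) / 2 + (\<Sum>i j. (\<theta>\<^sub>i\<^sub>j - \<theta>s\<^sub>i\<^sub>j)\<^sup>2 / (2 \<gamma>\<^sub>i\<^sub>j))\<close>.
  Along the dynamics the adaptation law turns the coefficient \<open>-\<theta>\<^sub>i\<^sub>j\<close> of the squared consensus error into
  the constant \<open>-\<theta>s\<^sub>i\<^sub>j\<close>, whatever the current gain is. Strong monotonicity contributes
  \<open>-m (norm (x - xs))\<^sup>2\<close>; the remaining terms come from evaluating gradients at estimates, and by the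
  Lipschitz property they are bounded by cross terms \<open>norm (x - xs) * norm (M w)\<close> and
  multiples of \<open>(norm (M w))\<^sup>2\<close>. Hence if all \<open>\<theta>s\<^sub>i\<^sub>j\<close> exceed a threshold, \<open>V\<close> decreases at rate at least
  \<open>(m/2) (norm (x - xs))\<^sup>2 + (norm (M w))\<^sup>2\<close> (\<open>lyapunov_deriv_field_le\<close>).

  The reference gains \<open>\<theta>s\<close> are a parameter of \<open>V\<close> only, not of the dynamics, and the two halves of the
  result use them differently. Taking \<open>\<theta>s\<close> to be the gains of a given equilibrium makes \<open>V\<close> vanish
  there and nowhere else, which gives Lyapunov stability. Taking \<open>\<theta>s\<close> constant and equal to the threshold
  gives, for arbitrary initial data, bounded trajectories; these therefore exist for all
  times (\<open>lyapunov_imp_global_solution\<close>) and are Lipschitz in time, so that a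
  Barbalat argument (\<open>barbalat\<close>) drives both dissipated quantities to zero. The gains are nondecreasing
  and bounded, hence convergent.\<close>

section \<open>Functions that are Lipschitz on balls\<close>

text \<open>Being Lipschitz on every ball is the regularity that the closed loop has: its right-hand side contains
  products of gains and consensus errors and is not globally Lipschitz. The property is stable under products
  and is tested componentwise.\<close>

definition lipschitz_on_balls :: "('a::real_normed_vector \<Rightarrow> 'b::metric_space) \<Rightarrow> bool" where
  "lipschitz_on_balls F \<longleftrightarrow> (\<forall>R. \<exists>L. L-lipschitz_on (cball 0 R) F)"

lemma lipschitz_on_balls_linear:
  assumes "bounded_linear F" shows "lipschitz_on_balls F"
  unfolding lipschitz_on_balls_def
  using bounded_linear.lipschitz_boundE[OF assms] by metis

lemma lipschitz_on_balls_const: "lipschitz_on_balls (\<lambda>_. c)"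
  unfolding lipschitz_on_balls_def using lipschitz_on_constant by blast

lemma lipschitz_on_balls_Pair:
  assumes "lipschitz_on_balls F" "lipschitz_on_balls G"
  shows "lipschitz_on_balls (\<lambda>z. (F z, G z))"
  using assms unfolding lipschitz_on_balls_def by (fast intro: lipschitz_on_Pair)

lemma lipschitz_on_balls_mult:
  fixes F G :: "'a::real_normed_vector \<Rightarrow> real"
  assumes "lipschitz_on_balls F" "lipschitz_on_balls G"
  shows "lipschitz_on_balls (\<lambda>z. F z * G z)"
  unfolding lipschitz_on_balls_def
proof
  fix R :: real
  obtain L M where L: "L-lipschitz_on (cball 0 R) F" and M: "M-lipschitz_on (cball 0 R) G"
    using assms unfolding lipschitz_on_balls_def by meson
  note nn = lipschitz_on_nonneg[OF L] lipschitz_on_nonneg[OF M]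
  obtain B where B: "\<bar>F z\<bar> \<le> B" "\<bar>G z\<bar> \<le> B" if "z \<in> cball 0 R" for z
  proof (rule that[of "max (\<bar>F 0\<bar> + L * R) (\<bar>G 0\<bar> + M * R)"])
    fix z :: 'a assume z: "z \<in> cball 0 R"
    then have 0: "0 \<in> cball (0::'a) R" and zR: "norm z \<le> R"
      using order_trans[OF norm_ge_zero, of z R] by simp_all
    have "\<bar>F z - F 0\<bar> \<le> L * R" "\<bar>G z - G 0\<bar> \<le> M * R"
      using lipschitz_on_normD[OF L z 0] lipschitz_on_normD[OF M z 0] zR nn
      by (auto intro: order_trans[OF _ mult_left_mono])
    then show "\<bar>F z\<bar> \<le> max (\<bar>F 0\<bar> + L * R) (\<bar>G 0\<bar> + M * R)" "\<bar>G z\<bar> \<le> max (\<bar>F 0\<bar> + L * R) (\<bar>G 0\<bar> + M * R)"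
      by linarith+
  qed
  show "\<exists>K. K-lipschitz_on (cball 0 R) (\<lambda>z. F z * G z)"
  proof (cases "cball (0::'a) R = {}")
    case False
    then obtain z where "z \<in> cball (0::'a) R" by blast
    then have B0: "0 \<le> B" using B(1) abs_ge_zero order_trans by blast
    have "(B * M + B * L)-lipschitz_on (cball 0 R) (\<lambda>z. F z * G z)"
    proof (rule lipschitz_onI)
      fix z w :: 'a assume z: "z \<in> cball 0 R" and w: "w \<in> cball 0 R"
      have "\<bar>F z * G z - F w * G w\<bar> = \<bar>F z * (G z - G w) + G w * (F z - F w)\<bar>"
        by (simp add: algebra_simps)
      also have "\<dots> \<le> \<bar>F z\<bar> * \<bar>G z - G w\<bar> + \<bar>G w\<bar> * \<bar>F z - F w\<bar>"
        by (metis abs_mult abs_triangle_ineq)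
      also have "\<dots> \<le> B * (M * dist z w) + B * (L * dist z w)"
        using B[OF z] B[OF w] B0 lipschitz_onD[OF L z w] lipschitz_onD[OF M z w] nn
        by (intro add_mono mult_mono) (auto simp: dist_real_def)
      finally show "dist (F z * G z) (F w * G w) \<le> (B * M + B * L) * dist z w"
        by (simp add: dist_real_def algebra_simps)
    qed (use B0 nn in simp)
    then show ?thesis by blast
  qed auto
qed

lemma lipschitz_on_balls_vec:
  fixes F :: "'a::real_normed_vector \<Rightarrow> 'b::real_normed_vector ^ 'n::finite"
  assumes "\<And>i. lipschitz_on_balls (\<lambda>z. F z $ i)"
  shows "lipschitz_on_balls F"
  unfolding lipschitz_on_balls_def
proof
  fix R :: real
  have "\<forall>i. \<exists>L. L-lipschitz_on (cball 0 R) (\<lambda>z. F z $ i)"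
    using assms unfolding lipschitz_on_balls_def by blast
  then obtain L where L: "\<And>i. (L i)-lipschitz_on (cball 0 R) (\<lambda>z. F z $ i)" by metis
  have "(\<Sum>i\<in>UNIV. L i)-lipschitz_on (cball 0 R) F"
  proof (rule lipschitz_onI)
    fix z w :: 'a assume zw: "z \<in> cball 0 R" "w \<in> cball 0 R"
    have "dist (F z) (F w) \<le> (\<Sum>i\<in>UNIV. dist (F z $ i) (F w $ i))"
      unfolding dist_vec_def by (rule L2_set_le_sum) simp
    also have "\<dots> \<le> (\<Sum>i\<in>UNIV. L i * dist z w)"
      by (intro sum_mono lipschitz_onD[OF L zw])
    finally show "dist (F z) (F w) \<le> (\<Sum>i\<in>UNIV. L i) * dist z w"
      by (simp add: sum_distrib_right)
  qed (auto intro!: sum_nonneg lipschitz_on_nonneg[OF L])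
  then show "\<exists>L. L-lipschitz_on (cball 0 R) F" by blast
qed

section \<open>Solutions on the half-line\<close>

lemma indefinite_integral_has_vector_derivative_halfline:
  fixes g :: "real \<Rightarrow> 'a::banach"
  assumes "continuous_on {0..} g" "t \<ge> 0"
  shows "((\<lambda>t. integral {0..t} g) has_vector_derivative g t) (at t within {0..})"
proof -
  have "((\<lambda>t. integral {0..t} g) has_vector_derivative g t) (at t within {0..t+1})"
    by (rule integral_has_vector_derivative) (use assms in \<open>auto intro: continuous_on_subset\<close>)
  moreover have "at t within {0..t+1} = at t within {0..}"
    by (rule at_within_nhd[of _ "{..<t+1}"]) auto
  ultimately show ?thesis by simp
qed

text \<open>A global Picard iteration. Solutions are sought in the form \<open>z t = z0 + exp (K t) u t\<close> with \<open>u\<close> bounded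
  and continuous. In the weighted supremum norm this induces, the integral operator has contraction constant
  \<open>L / K < 1\<close> on the whole half-line, so a single application of the Banach fixed point theorem replaces the
  gluing of local solutions.\<close>

theorem bounded_lipschitz_ode_has_solution:
  fixes F :: "'a::banach \<Rightarrow> 'a"
  assumes lip: "L-lipschitz_on UNIV F" and bdd: "\<And>z. norm (F z) \<le> B"
  shows "\<exists>z. z 0 = z0 \<and> ode_solution F z"
proof -
  define K where "K = L + 1"
  have L0: "0 \<le> L" using lip by (rule lipschitz_on_nonneg)
  then have K: "0 < K" by (simp add: K_def)
  have B0: "0 \<le> B" using bdd[of 0] norm_ge_zero[of "F 0"] by linarith
  define h where "h u s = F (z0 + exp (K * s) *\<^sub>R apply_bcontfun u s)"
    for u :: "real \<Rightarrow>\<^sub>C 'a" and s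
  define I where "I u t = integral {0..t} (h u)" for u t
  have cont_F: "continuous_on S F" for S
    using lipschitz_on_continuous_on[OF lip] continuous_on_subset by blast
  have cont_h: "continuous_on S (h u)" for S u
    unfolding h_def by (rule continuous_on_compose2[OF cont_F[of UNIV]]) (auto intro!: continuous_intros)
  have int_h: "h u integrable_on {0..t}" for u t
    by (rule integrable_continuous_real[OF cont_h])
  have deriv_I: "(I u has_vector_derivative h u t) (at t within {0..})" if "t \<ge> 0" for u t
    using indefinite_integral_has_vector_derivative_halfline[OF cont_h that] by (simp add: I_def[abs_def])
  have cont_I: "continuous_on {0..} (I u)" for u
    unfolding continuous_on_eq_continuous_within
    using deriv_I has_vector_derivative_continuous by fastforce
  \<comment> \<open>Functions are extended to negative times by their value at 0, since the fixed point is taken among bounded continuous functions on the whole line.\<close>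
  define P where "P u t = exp (- K * max 0 t) *\<^sub>R I u (max 0 t)" for u t
  have cont_P: "continuous_on UNIV (P u)" for u
    unfolding P_def
    by (intro continuous_intros continuous_on_compose2[OF cont_I]) auto
  have bound_P: "norm (P u t) \<le> B / K" for u t
  proof -
    define s where "s = max 0 t"
    have s: "0 \<le> s" by (simp add: s_def)
    have "norm (I u s) \<le> integral {0..s} (\<lambda>_. B)"
      unfolding I_def by (rule integral_norm_bound_integral[OF int_h]) (auto simp: h_def bdd)
    also have "\<dots> = B * s" using s by simp
    finally have I: "norm (I u s) \<le> B * s" .
    \<comment> \<open>The integral grows at most linearly, and the exponential weight absorbs that growth.\<close>
    have "K * s \<le> exp (K * s)" using exp_ge_add_one_self[of "K * s"] by linarith
    then have "exp (- K * s) * s \<le> 1 / K"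
      using K by (simp add: exp_minus field_simps)
    then have "exp (- K * s) * (B * s) \<le> B * (1 / K)"
      using B0 by (metis mult.left_commute mult_left_mono)
    moreover have "norm (P u t) \<le> exp (- K * s) * (B * s)"
      using I by (simp add: P_def s_def)
    ultimately show ?thesis by simp
  qed
  have P_bcontfun: "P u \<in> bcontfun" for u
    by (rule bcontfun_normI[OF cont_P bound_P])
  define \<Phi> where "\<Phi> u = Bcontfun (P u)" for u
  have \<Phi>: "apply_bcontfun (\<Phi> u) = P u" for u
    using P_bcontfun by (simp add: \<Phi>_def Bcontfun_inverse)
  have contraction: "dist (\<Phi> u) (\<Phi> v) \<le> L / K * dist u v" for u v
  proof (rule dist_bound)
    fix t :: real
    define s where "s = max 0 t"
    have s: "0 \<le> s" by (simp add: s_def)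
    define D where "D = dist u v"
    have D0: "0 \<le> D" by (simp add: D_def)
    have pt: "norm (h u r - h v r) \<le> L * D * exp (K * r)" for r
    proof -
      have "norm (h u r - h v r) \<le> L * norm (exp (K * r) *\<^sub>R (u r - v r))"
        using lipschitz_on_normD[OF lip, of "z0 + exp (K * r) *\<^sub>R u r" "z0 + exp (K * r) *\<^sub>R v r"]
        by (simp add: h_def scaleR_diff_right)
      also have "\<dots> = L * (exp (K * r) * dist (u r) (v r))" by (simp add: dist_norm)
      also have "\<dots> \<le> L * (exp (K * r) * D)"
        using dist_bounded[of u r v] L0 by (intro mult_left_mono) (auto simp: D_def)
      finally show ?thesis by (simp add: mult_ac)
    qed
    have prim: "((\<lambda>r. L * D * exp (K * r)) has_integral
        (L * D * exp (K * s) / K - L * D * exp (K * 0) / K)) {0..s}"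
      by (rule fundamental_theorem_of_calculus[OF s])
         (use K in \<open>auto intro!: derivative_eq_intros simp: has_real_derivative_iff_has_vector_derivative[symmetric]\<close>)
    have "norm (I u s - I v s) = norm (integral {0..s} (\<lambda>r. h u r - h v r))"
      unfolding I_def by (subst Henstock_Kurzweil_Integration.integral_diff[OF int_h int_h]) simp
    also have "\<dots> \<le> integral {0..s} (\<lambda>r. L * D * exp (K * r))"
      by (rule integral_norm_bound_integral)
         (use pt prim in \<open>auto intro!: Henstock_Kurzweil_Integration.integrable_diff int_h\<close>)
    also have "\<dots> = L * D * exp (K * s) / K - L * D / K"
      using integral_unique[OF prim] by simp
    also have "\<dots> \<le> L * D * exp (K * s) / K"
      using L0 D0 K by simp
    finally have "exp (- K * s) * norm (I u s - I v s) \<le> exp (- K * s) * (L * D * exp (K * s) / K)"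
      by (intro mult_left_mono) auto
    also have "\<dots> = L / K * D" by (simp add: exp_minus field_simps)
    finally show "dist (apply_bcontfun (\<Phi> u) t) (apply_bcontfun (\<Phi> v) t) \<le> L / K * dist u v"
      by (simp add: \<Phi> P_def s_def D_def dist_norm scaleR_diff_right[symmetric])
  qed
  have "L / K < 1" "0 \<le> L / K" using K L0 by (auto simp: K_def)
  then obtain u where u: "\<Phi> u = u"
    using banach_fix_type[of "L / K" \<Phi>] contraction by blast
  define z where "z t = z0 + I u t" for t
  have z_eq: "z t = z0 + exp (K * t) *\<^sub>R u t" if "t \<ge> 0" for t
  proof -
    have "u t = exp (- K * t) *\<^sub>R I u t"
      using arg_cong[OF u, of "\<lambda>w. apply_bcontfun w t"] that by (simp add: \<Phi> P_def)
    then show ?thesis by (simp add: z_def exp_minus)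
  qed
  have "(z has_vector_derivative F (z t)) (at t within {0..})" if "t \<ge> 0" for t
    using deriv_I[OF that, of u] z_eq[OF that]
    unfolding z_def[abs_def] h_def by (auto intro!: derivative_eq_intros)
  moreover have "z 0 = z0" by (simp add: z_def I_def)
  ultimately show ?thesis unfolding ode_solution_def by blast
qed

lemma halfline_derivative_decrease:
  fixes g :: "real \<Rightarrow> real"
  assumes deriv: "\<And>t. t \<ge> 0 \<Longrightarrow> (g has_real_derivative g' t) (at t within {0..})"
    and bound: "\<And>t. a \<le> t \<Longrightarrow> t \<le> b \<Longrightarrow> g' t \<le> - c"
    and ab: "0 \<le> a" "a \<le> b"
  shows "g b \<le> g a - c * (b - a)"
proof -
  have "\<exists>t\<in>{a..b}. g b - g a = (\<lambda>h. g' t * h) (b - a)"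
  proof (rule mvt_very_simple[OF ab(2)])
    fix t assume "a \<le> t" "t \<le> b"
    then have "(g has_real_derivative g' t) (at t within {a..b})"
      using deriv[of t] ab by (auto elim: DERIV_subset)
    then show "(g has_derivative (\<lambda>h. g' t * h)) (at t within {a..b})"
      by (simp add: has_field_derivative_def)
  qed
  then obtain t where t: "t \<in> {a..b}" and eq: "g b - g a = g' t * (b - a)" by auto
  have "g' t * (b - a) \<le> - c * (b - a)"
    using t bound[of t] ab by (intro mult_right_mono) auto
  with eq show ?thesis by (simp add: algebra_simps)
qed

lemma derivative_along_solution:
  fixes V :: "'a::real_normed_vector \<Rightarrow> real"
  assumes V: "\<And>z. (V has_derivative V' z) (at z)"
    and sol: "ode_solution F z" and t: "t \<ge> 0"
  shows "((\<lambda>t. V (z t)) has_real_derivative V' (z t) (F (z t))) (at t within {0..})"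
proof -
  have z: "(z has_derivative (\<lambda>h. h *\<^sub>R F (z t))) (at t within {0..})"
    using sol t by (simp add: ode_solution_def has_vector_derivative_def)
  have lin: "linear (V' (z t))" using V has_derivative_linear by blast
  have "((\<lambda>t. V (z t)) has_derivative (\<lambda>h. V' (z t) (h *\<^sub>R F (z t)))) (at t within {0..})"
    by (rule has_derivative_compose[OF z V])
  moreover have "(\<lambda>h. V' (z t) (h *\<^sub>R F (z t))) = (*) (V' (z t) (F (z t)))"
    by (simp add: fun_eq_iff linear_cmul[OF lin] mult.commute)
  ultimately show ?thesis by (simp add: has_field_derivative_def)
qed

lemma lyapunov_function_nonincreasing:
  fixes V :: "'a::real_normed_vector \<Rightarrow> real"
  assumes V: "\<And>z. (V has_derivative V' z) (at z)"
    and sol: "ode_solution F z"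
    and dec: "\<And>z. V' z (F z) \<le> 0"
    and st: "0 \<le> s" "s \<le> t"
  shows "V (z t) \<le> V (z s)"
  using halfline_derivative_decrease[of "\<lambda>t. V (z t)" "\<lambda>t. V' (z t) (F (z t))" s t 0]
    derivative_along_solution[OF V sol] dec st by auto

text \<open>Multiply \<open>F\<close> by a cutoff \<open>\<phi>\<close> that is \<open>1\<close> on a ball containing
  the initial sublevel set and \<open>0\<close> outside a larger ball. The product is bounded and globally Lipschitz,
  so it has a global solution. Since \<open>\<phi> \<ge> 0\<close>, the function \<open>V\<close> decreases along \<open>\<phi> F\<close> as well, so this
  solution stays where \<open>\<phi> = 1\<close> and solves the original equation.\<close>

theorem lyapunov_imp_global_solution:
  fixes F :: "'a::banach \<Rightarrow> 'a"
  assumes lip: "lipschitz_on_balls F"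
    and V: "\<And>z. (V has_derivative V' z) (at z)"
    and dec: "\<And>z. V' z (F z) \<le> 0"
    and sublevel: "bounded {z. V z \<le> (V z0 :: real)}"
  shows "\<exists>z. z 0 = z0 \<and> ode_solution F z"
proof -
  obtain R where R: "norm z \<le> R" if "V z \<le> V z0" for z
    using sublevel unfolding bounded_iff by auto
  have R0: "0 \<le> R" using R[of z0] norm_ge_zero[of z0] by linarith
  obtain L where L: "L-lipschitz_on (cball 0 (R + 1)) F"
    using lip unfolding lipschitz_on_balls_def by blast
  have L0: "0 \<le> L" using L by (rule lipschitz_on_nonneg)
  define B where "B = norm (F 0) + L * (R + 1)"
  have B: "norm (F z) \<le> B" if "norm z \<le> R + 1" for z
  proof -
    have "norm (F z - F 0) \<le> L * norm (z - 0)"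
      using R0 that by (intro lipschitz_on_normD[OF L]) auto
    also have "\<dots> \<le> L * (R + 1)" using that L0 by (intro mult_left_mono) auto
    finally show ?thesis unfolding B_def using norm_triangle_sub[of "F z" "F 0"] by linarith
  qed
  have B0: "0 \<le> B" using order_trans[OF norm_ge_zero B[of 0]] R0 by simp
  define \<phi> where "\<phi> z = max 0 (min 1 (R + 1 - norm z))" for z :: 'a
  have \<phi>_range: "0 \<le> \<phi> z" "\<phi> z \<le> 1" for z by (auto simp: \<phi>_def)
  have \<phi>_lip: "\<bar>\<phi> z - \<phi> w\<bar> \<le> norm (z - w)" for z w
    using norm_triangle_ineq3[of z w] by (auto simp: \<phi>_def)
  have \<phi>_out: "\<phi> z = 0" if "R + 1 \<le> norm z" for z using that by (auto simp: \<phi>_def)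
  have \<phi>_in: "\<phi> z = 1" if "norm z \<le> R" for z using that by (auto simp: \<phi>_def)
  define G where "G z = \<phi> z *\<^sub>R F z" for z
  have half: "norm (G z - G w) \<le> (B + L) * norm (z - w)" if z: "norm z \<le> R + 1" for z w
  proof -
    \<comment> \<open>The factor \<open>F\<close> whose size has to be bounded is the one at the point inside the ball; at the other point only the difference occurs, with weight \<open>\<phi> w\<close> vanishing outside.\<close>
    have "norm (G z - G w) = norm ((\<phi> z - \<phi> w) *\<^sub>R F z + \<phi> w *\<^sub>R (F z - F w))"
      by (simp add: G_def algebra_simps)
    also have "\<dots> \<le> \<bar>\<phi> z - \<phi> w\<bar> * norm (F z) + \<phi> w * norm (F z - F w)"
      using norm_triangle_ineq[of "(\<phi> z - \<phi> w) *\<^sub>R F z"] \<phi>_range[of w] by (metis abs_of_nonneg norm_scaleR)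
    also have "\<dots> \<le> norm (z - w) * B + L * norm (z - w)"
    proof (rule add_mono)
      show "\<bar>\<phi> z - \<phi> w\<bar> * norm (F z) \<le> norm (z - w) * B"
        using \<phi>_lip B[OF z] by (intro mult_mono) auto
      show "\<phi> w * norm (F z - F w) \<le> L * norm (z - w)"
      proof (cases "norm w \<le> R + 1")
        case True
        then have "norm (F z - F w) \<le> L * norm (z - w)"
          using z by (intro lipschitz_on_normD[OF L]) auto
        then show ?thesis
          using \<phi>_range[of w] mult_mono[of "\<phi> w" 1 "norm (F z - F w)" "L * norm (z - w)"] by simp
      qed (use \<phi>_out[of w] L0 in simp)
    qed
    finally show ?thesis by (simp add: algebra_simps)
  qed
  have "(B + L)-lipschitz_on UNIV G"
  proof (rule lipschitz_onI)
    fix z w :: 'a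
    consider "norm z \<le> R + 1" | "norm w \<le> R + 1" | "R + 1 \<le> norm z" "R + 1 \<le> norm w" by linarith
    then show "dist (G z) (G w) \<le> (B + L) * dist z w"
    proof cases
      case 1 then show ?thesis using half by (simp add: dist_norm)
    next
      case 2 then show ?thesis using half[of w z] by (simp add: dist_norm norm_minus_commute)
    next
      case 3 then show ?thesis using \<phi>_out B0 L0 by (simp add: G_def)
    qed
  qed (use B0 L0 in simp)
  moreover have "norm (G z) \<le> B" for z
  proof (cases "norm z \<le> R + 1")
    case True
    then show ?thesis
      using B[OF True] \<phi>_range[of z] mult_mono[of "\<phi> z" 1 "norm (F z)" B] by (simp add: G_def)
  qed (use \<phi>_out[of z] B0 in \<open>simp add: G_def\<close>)
  ultimately obtain z where z: "z 0 = z0" "ode_solution G z"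
    using bounded_lipschitz_ode_has_solution by blast
  have "V' w (G w) \<le> 0" for w
  proof -
    have "V' w (G w) = \<phi> w * V' w (F w)"
      using linear_cmul[OF has_derivative_linear[OF V]] by (simp add: G_def)
    then show ?thesis using \<phi>_range(1)[of w] dec[of w] by (simp add: mult_nonneg_nonpos)
  qed
  then have "V (z t) \<le> V z0" if "t \<ge> 0" for t
    using lyapunov_function_nonincreasing[OF V z(2), of 0 t] that z(1) by simp
  then have "G (z t) = F (z t)" if "t \<ge> 0" for t using R \<phi>_in that by (simp add: G_def)
  then have "ode_solution F z" using z(2) by (simp add: ode_solution_def)
  with z(1) show ?thesis by blast
qed

section \<open>Convergence along bounded solutions\<close>

lemma bounded_solution_lipschitz:
  fixes F :: "'a::banach \<Rightarrow> 'a"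
  assumes lip: "lipschitz_on_balls F"
    and sol: "ode_solution F z" and bdd: "bounded (z ` {0..})"
  shows "\<exists>C. C-lipschitz_on {0..} z"
proof -
  obtain R where "\<forall>w\<in>z ` {0..}. norm w \<le> R" using bdd unfolding bounded_iff by blast
  then have R: "norm (z t) \<le> R" if "t \<ge> 0" for t using that by auto
  then have R0: "0 \<le> R" by (meson norm_ge_zero order_refl order_trans)
  obtain L where L: "L-lipschitz_on (cball 0 R) F"
    using lip unfolding lipschitz_on_balls_def by blast
  define B where "B = norm (F 0) + L * R"
  have B: "norm (F (z t)) \<le> B" if "t \<ge> 0" for t
  proof -
    have "norm (F (z t) - F 0) \<le> L * norm (z t - 0)"
      using R[OF that] R0 by (intro lipschitz_on_normD[OF L]) auto
    also have "\<dots> \<le> L * R" using R[OF that] lipschitz_on_nonneg[OF L] by (intro mult_left_mono) auto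
    finally show ?thesis unfolding B_def using norm_triangle_sub[of "F (z t)" "F 0"] by linarith
  qed
  have B0: "0 \<le> B" using B[of 0] norm_ge_zero[of "F (z 0)"] by linarith
  have "norm (z s - z t) \<le> B * norm (s - t)" if "s \<in> {0..}" "t \<in> {0..}" for s t
  proof (rule differentiable_bound[OF _ _ _ that])
    fix r :: real assume r: "r \<in> {0..}"
    then show "(z has_derivative (\<lambda>h. h *\<^sub>R F (z r))) (at r within {0..})"
      using sol by (simp add: ode_solution_def has_vector_derivative_def)
    show "onorm (\<lambda>h. h *\<^sub>R F (z r)) \<le> B"
      by (rule onorm_bound[OF B0]) (use r B in \<open>auto simp: mult.commute[of B] intro!: mult_left_mono\<close>)
  qed simp
  then show ?thesis using B0 by (auto simp: lipschitz_on_def dist_norm)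
qed

text \<open>If \<open>\<phi>\<close> exceeded \<open>\<epsilon>\<close> at arbitrarily late times, the Lipschitz bound would keep it above \<open>\<epsilon> / 2\<close> for a
  fixed time \<open>d\<close> afterwards, and during each such interval \<open>V\<close> would lose a fixed amount \<open>\<eta>\<close>. That is
  impossible once \<open>V\<close> is within \<open>\<eta>\<close> of its infimum.\<close>

theorem barbalat:
  fixes \<phi> V :: "real \<Rightarrow> real"
  assumes deriv: "\<And>t. t \<ge> 0 \<Longrightarrow> (V has_real_derivative V' t) (at t within {0..})"
    and dec: "\<And>t. t \<ge> 0 \<Longrightarrow> V' t \<le> - c * (\<phi> t)\<^sup>2" and c: "0 < c"
    and V0: "\<And>t. t \<ge> 0 \<Longrightarrow> 0 \<le> V t"
    and lip: "C-lipschitz_on {0..} \<phi>"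
  shows "(\<phi> \<longlongrightarrow> 0) at_top"
proof (rule tendstoI)
  fix \<epsilon> :: real assume \<epsilon>: "0 < \<epsilon>"
  have C0: "0 \<le> C" using lip by (rule lipschitz_on_nonneg)
  \<comment> \<open>\<open>C + 1\<close> instead of \<open>C\<close> keeps the denominator positive for a constant \<open>\<phi>\<close>.\<close>
  define d where "d = \<epsilon> / (2 * (C + 1))"
  have d: "0 < d" using \<epsilon> C0 by (simp add: d_def)
  have Cd: "C * d \<le> \<epsilon> / 2"
    using \<epsilon> C0 by (simp add: d_def field_simps)
  have mono: "V t \<le> V s" if "0 \<le> s" "s \<le> t" for s t
  proof -
    have "V' r \<le> - 0" if "s \<le> r" "r \<le> t" for r
    proof -
      have "0 \<le> c * (\<phi> r)\<^sup>2" using c by simp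
      then show ?thesis using dec[of r] that \<open>0 \<le> s\<close> by linarith
    qed
    then show ?thesis using halfline_derivative_decrease[OF deriv, of s t 0] that by auto
  qed
  define \<eta> where "\<eta> = c * (\<epsilon> / 2)\<^sup>2 * d"
  have \<eta>: "0 < \<eta>" using c d \<epsilon> by (simp add: \<eta>_def)
  define v where "v = Inf (V ` {0..})"
  have bb: "bdd_below (V ` {0..})" using V0 by (auto intro!: bdd_belowI[of _ 0])
  have "Inf (V ` {0..}) < v + \<eta>" using \<eta> by (simp add: v_def)
  then have "\<exists>y\<in>V ` {0..}. y < v + \<eta>" by (subst (asm) cInf_less_iff[OF _ bb]) auto
  then obtain T where T: "0 \<le> T" "V T < v + \<eta>" by auto
  have "dist (\<phi> t) 0 < \<epsilon>" if "T \<le> t" for t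
  proof (rule ccontr)
    assume "\<not> dist (\<phi> t) 0 < \<epsilon>"
    then have big: "\<epsilon> \<le> \<bar>\<phi> t\<bar>" by simp
    have t0: "0 \<le> t" using T that by simp
    have "V' s \<le> - (c * (\<epsilon> / 2)\<^sup>2)" if s: "t \<le> s" "s \<le> t + d" for s
    proof -
      have "\<bar>\<phi> t - \<phi> s\<bar> \<le> C * \<bar>t - s\<bar>"
        using lipschitz_on_normD[OF lip, of t s] t0 s by simp
      also have "\<dots> \<le> C * d" using s C0 by (intro mult_left_mono) auto
      finally have "\<epsilon> / 2 \<le> \<bar>\<phi> s\<bar>" using big Cd by linarith
      then have "(\<epsilon> / 2)\<^sup>2 \<le> (\<phi> s)\<^sup>2" using \<epsilon> power_mono[of "\<epsilon> / 2" "\<bar>\<phi> s\<bar>" 2] by simp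
      then have "c * (\<epsilon> / 2)\<^sup>2 \<le> c * (\<phi> s)\<^sup>2" using c by simp
      then show ?thesis using dec[of s] s t0 by linarith
    qed
    then have "V (t + d) \<le> V t - \<eta>"
      using halfline_derivative_decrease[OF deriv, of t "t + d" "c * (\<epsilon> / 2)\<^sup>2"] t0 d
      by (simp add: \<eta>_def)
    moreover have "v \<le> V (t + d)"
      unfolding v_def using t0 d by (intro cInf_lower[OF _ bb]) auto
    moreover have "V t \<le> V T" using mono[OF T(1) that] .
    ultimately show False using T(2) by linarith
  qed
  then show "\<forall>\<^sub>F t in at_top. dist (\<phi> t) 0 < \<epsilon>"
    unfolding eventually_at_top_linorder by blast
qed

lemma bounded_nondecreasing_converges:
  fixes g :: "real \<Rightarrow> real"
  assumes mono: "\<And>s t. 0 \<le> s \<Longrightarrow> s \<le> t \<Longrightarrow> g s \<le> g t"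
    and bdd: "bdd_above (g ` {0..})"
  shows "\<exists>c. (g \<longlongrightarrow> c) at_top"
proof -
  have "(g \<longlongrightarrow> Sup (g ` {0..})) at_top"
  proof (rule increasing_tendsto)
    show "\<forall>\<^sub>F t in at_top. g t \<le> Sup (g ` {0..})"
      using eventually_ge_at_top[of 0] by eventually_elim (auto intro!: cSup_upper bdd)
    fix y assume "y < Sup (g ` {0..})"
    then obtain s where "0 \<le> s" "y < g s" using less_cSup_iff[OF _ bdd] by fastforce
    then show "\<forall>\<^sub>F t in at_top. y < g t"
      using mono unfolding eventually_at_top_linorder by (meson less_le_trans)
  qed
  then show ?thesis by blast
qed

section \<open>Gradients of the game\<close>

text \<open>First-order optimality: player \<open>i\<close>'s own action minimises the cost along the line through \<open>xs\<close> in direction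
  \<open>i\<close>, so the derivative along that line vanishes.\<close>

lemma nash_equilibrium_pseudo_gradient_zero:
  fixes f :: "'n::finite \<Rightarrow> real ^ 'n \<Rightarrow> real"
  assumes diff: "\<And>i. f i differentiable (at xs)" and nash: "nash_equilibrium f xs"
  shows "pseudo_gradient f xs = 0"
proof -
  have "partial_deriv i (f i) xs = 0" for i
  proof -
    have wa: "with_action xs i u = xs + (u - xs $ i) *\<^sub>R axis i 1" for u
      by (auto simp: with_action_def vec_eq_iff axis_def)
    have "with_action xs i differentiable (at (xs $ i))"
      unfolding wa[abs_def] by (auto intro!: derivative_intros)
    moreover have "f i differentiable (at (with_action xs i (xs $ i)))"
      using diff by (simp add: wa)
    ultimately have "(\<lambda>u. f i (with_action xs i u)) differentiable (at (xs $ i))"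
      using differentiable_chain_at[of "with_action xs i" "xs $ i" "f i"] by (simp add: o_def)
    then have D: "DERIV (\<lambda>u. f i (with_action xs i u)) (xs $ i) :> deriv (\<lambda>u. f i (with_action xs i u)) (xs $ i)"
      by (simp add: DERIV_deriv_iff_real_differentiable)
    have "f i (with_action xs i (xs $ i)) \<le> f i (with_action xs i u)" for u
      using nash unfolding nash_equilibrium_def by (simp add: wa[of "xs $ i"])
    then show ?thesis
      using DERIV_local_min[OF D zero_less_one] unfolding partial_deriv_def by blast
  qed
  then show ?thesis by (simp add: pseudo_gradient_def vec_eq_iff)
qed

definition estimated_gradient :: "('n \<Rightarrow> real ^ 'n \<Rightarrow> real) \<Rightarrow> real ^ 'n ^ 'n \<Rightarrow> real ^ 'n" where
  "estimated_gradient f y = (\<chi> i. partial_deriv i (f i) (y $ i))"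

lemma estimated_gradient_stacked_copies:
  "estimated_gradient f (stacked_copies x) = pseudo_gradient f x"
  by (simp add: estimated_gradient_def pseudo_gradient_def stacked_copies_def)

lemma estimated_gradient_lipschitz:
  fixes f :: "'n::finite \<Rightarrow> real ^ 'n \<Rightarrow> real"
  assumes l: "\<And>i. 0 \<le> l i"
    and lip: "\<And>i x z. \<bar>partial_deriv i (f i) x - partial_deriv i (f i) z\<bar> \<le> l i * norm (x - z)"
  shows "(\<Sum>i\<in>UNIV. l i)-lipschitz_on UNIV (estimated_gradient f)"
proof (rule lipschitz_onI)
  fix y v :: "real ^ 'n ^ 'n"
  have "norm (estimated_gradient f y - estimated_gradient f v)
      \<le> (\<Sum>i\<in>UNIV. \<bar>(estimated_gradient f y - estimated_gradient f v) $ i\<bar>)"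
    by (rule norm_le_l1_cart)
  also have "\<dots> \<le> (\<Sum>i\<in>UNIV. l i * norm (y - v))"
  proof (rule sum_mono)
    fix i
    have "\<bar>(estimated_gradient f y - estimated_gradient f v) $ i\<bar> \<le> l i * norm (y $ i - v $ i)"
      using lip by (simp add: estimated_gradient_def)
    also have "\<dots> \<le> l i * norm (y - v)"
      using Finite_Cartesian_Product.norm_nth_le[of "y - v" i] l by (intro mult_left_mono) auto
    finally show "\<bar>(estimated_gradient f y - estimated_gradient f v) $ i\<bar> \<le> l i * norm (y - v)" .
  qed
  finally show "dist (estimated_gradient f y) (estimated_gradient f v) \<le> (\<Sum>i\<in>UNIV. l i) * dist y v"
    by (simp add: dist_norm sum_distrib_right)
qed (simp add: sum_nonneg l)

section \<open>The consensus operator of a connected graph\<close>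

lemma norm_matrix_power2: "(norm (A :: real ^ 'n ^ 'm))\<^sup>2 = (\<Sum>i\<in>UNIV. \<Sum>j\<in>UNIV. (A $ i $ j)\<^sup>2)"
  unfolding power2_norm_eq_inner by (simp add: inner_vec_def power2_eq_square)

lemma bounded_linear_entry:
  assumes "bounded_linear (T :: 'a::real_normed_vector \<Rightarrow> real ^ 'n ^ 'm)"
  shows "bounded_linear (\<lambda>z. T z $ i $ j)"
  by (rule bounded_linear_compose[OF bounded_linear_vec_nth bounded_linear_compose[OF bounded_linear_vec_nth assms]])

lemma bounded_linear_stacked_copies: "bounded_linear (stacked_copies :: real ^ 'n::finite \<Rightarrow> _)"
  unfolding linear_conv_bounded_linear[symmetric]
  by (rule linearI) (simp_all add: stacked_copies_def vec_eq_iff)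

lemma norm_stacked_copies_le:
  "norm (stacked_copies (v :: real ^ 'n::finite)) \<le> real CARD('n) * norm v"
proof -
  have "norm (stacked_copies v) \<le> (\<Sum>i\<in>(UNIV::'n set). norm (stacked_copies v $ i))"
    unfolding norm_vec_def[of "stacked_copies v"] by (rule L2_set_le_sum) simp
  then show ?thesis by (simp add: stacked_copies_def)
qed

definition consensus_map :: "('n::finite \<times> 'n) set \<Rightarrow> real ^ 'n ^ 'n \<Rightarrow> real ^ 'n ^ 'n" where
  "consensus_map E w =
     (\<chi> i j. (\<Sum>k\<in>UNIV. adjacency E i k * (w $ i $ j - w $ k $ j)) + adjacency E i j * w $ i $ j)"

lemma consensus_error_eq_consensus_map:
  "consensus_error E x y i j = consensus_map E (y - stacked_copies x) $ i $ j"
  by (simp add: consensus_error_def consensus_map_def stacked_copies_def)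

lemma bounded_linear_consensus_map: "bounded_linear (consensus_map E)"
  unfolding linear_conv_bounded_linear[symmetric]
proof (rule linearI)
  show "consensus_map E (v + w) = consensus_map E v + consensus_map E w" for v w
    by (simp add: consensus_map_def vec_eq_iff algebra_simps sum.distrib sum_subtractf)
  show "consensus_map E (r *\<^sub>R w) = r *\<^sub>R consensus_map E w" for r w
    by (simp add: consensus_map_def vec_eq_iff algebra_simps sum_distrib_left sum_subtractf)
qed

text \<open>Averaging the sum with the one in which \<open>i\<close> and \<open>k\<close> are exchanged turns the Laplacian into a form that is
  visibly symmetric and, on the diagonal, a sum of squares.\<close>

lemma laplacian_bilinear_form:
  fixes a :: "'n::finite \<Rightarrow> 'n \<Rightarrow> real"
  assumes sym: "\<And>i k. a i k = a k i"
  shows "(\<Sum>i\<in>UNIV. u i * (\<Sum>k\<in>UNIV. a i k * (v i - v k))) =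
    (\<Sum>i\<in>UNIV. \<Sum>k\<in>UNIV. a i k * (u i - u k) * (v i - v k)) / 2"
proof -
  define S where "S = (\<Sum>i\<in>UNIV. \<Sum>k\<in>UNIV. a i k * u i * (v i - v k))"
  have "S = (\<Sum>k\<in>UNIV. \<Sum>i\<in>UNIV. a i k * u i * (v i - v k))"
    unfolding S_def by (rule sum.swap)
  also have "\<dots> = (\<Sum>i\<in>UNIV. \<Sum>k\<in>UNIV. - (a i k * u k * (v i - v k)))"
    by (intro sum.cong refl) (simp add: sym algebra_simps)
  finally have "S + S = (\<Sum>i\<in>UNIV. \<Sum>k\<in>UNIV. a i k * u i * (v i - v k) + - (a i k * u k * (v i - v k)))"
    unfolding S_def sum.distrib by simp
  also have "\<dots> = (\<Sum>i\<in>UNIV. \<Sum>k\<in>UNIV. a i k * (u i - u k) * (v i - v k))"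
    by (intro sum.cong refl) (simp add: algebra_simps)
  finally have "S = (\<Sum>i\<in>UNIV. \<Sum>k\<in>UNIV. a i k * (u i - u k) * (v i - v k)) / 2" by simp
  moreover have "(\<Sum>i\<in>UNIV. u i * (\<Sum>k\<in>UNIV. a i k * (v i - v k))) = S"
    unfolding S_def by (simp add: sum_distrib_left mult_ac)
  ultimately show ?thesis by simp
qed

lemma inner_consensus_map:
  fixes E :: "('n::finite \<times> 'n) set"
  assumes "sym E"
  shows "u \<bullet> consensus_map E v =
    (\<Sum>j\<in>UNIV. (\<Sum>i\<in>UNIV. \<Sum>k\<in>UNIV. adjacency E i k * (u $ i $ j - u $ k $ j) * (v $ i $ j - v $ k $ j)) / 2
      + (\<Sum>i\<in>UNIV. adjacency E i j * u $ i $ j * v $ i $ j))"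
proof -
  have adj: "adjacency E i k = adjacency E k i" for i k
    using assms by (auto simp: adjacency_def dest: symD)
  have "u \<bullet> consensus_map E v = (\<Sum>i\<in>UNIV. \<Sum>j\<in>UNIV. u $ i $ j * consensus_map E v $ i $ j)"
    by (simp add: inner_vec_def)
  also have "\<dots> = (\<Sum>j\<in>UNIV. \<Sum>i\<in>UNIV. u $ i $ j * consensus_map E v $ i $ j)"
    by (rule sum.swap)
  also have "\<dots> = (\<Sum>j\<in>UNIV. (\<Sum>i\<in>UNIV. u $ i $ j * (\<Sum>k\<in>UNIV. adjacency E i k * (v $ i $ j - v $ k $ j)))
      + (\<Sum>i\<in>UNIV. adjacency E i j * u $ i $ j * v $ i $ j))"
    by (simp add: consensus_map_def distrib_left sum.distrib mult_ac)
  also have "\<dots> = (\<Sum>j\<in>UNIV. (\<Sum>i\<in>UNIV. \<Sum>k\<in>UNIV. adjacency E i k * (u $ i $ j - u $ k $ j) * (v $ i $ j - v $ k $ j)) / 2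
      + (\<Sum>i\<in>UNIV. adjacency E i j * u $ i $ j * v $ i $ j))"
    by (simp only: laplacian_bilinear_form[OF adj])
  finally show ?thesis .
qed

lemma consensus_map_self_adjoint:
  assumes "sym E" shows "u \<bullet> consensus_map E v = v \<bullet> consensus_map E u"
  unfolding inner_consensus_map[OF assms] by (simp add: mult_ac)

text \<open>If the form vanishes at \<open>w\<close>, the differences force every column of \<open>w\<close> to be constant along edges, hence
  constant by connectedness. The term \<open>adjacency E i j\<close> pins column \<open>j\<close> to zero at any neighbour of \<open>j\<close>;
  that a neighbour exists is where at least two vertices are needed.\<close>

lemma consensus_map_positive_definite:
  fixes E :: "('n::finite \<times> 'n) set"
  assumes card: "CARD('n) \<ge> 2" and graph: "undirected_connected_graph E" and w: "w \<noteq> 0"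
  shows "0 < w \<bullet> consensus_map E w"
proof -
  have sym: "sym E" and conn: "\<And>i j. (i, j) \<in> E\<^sup>*"
    using graph by (auto simp: undirected_connected_graph_def)
  have adj0: "0 \<le> adjacency E i k" for i k by (simp add: adjacency_def)
  define D where "D j = (\<Sum>i\<in>UNIV. \<Sum>k\<in>UNIV. adjacency E i k * (w $ i $ j - w $ k $ j)\<^sup>2)" for j
  define P where "P j = (\<Sum>i\<in>UNIV. adjacency E i j * (w $ i $ j)\<^sup>2)" for j
  have D0: "0 \<le> D j" and P0: "0 \<le> P j" for j
    unfolding D_def P_def by (auto intro!: sum_nonneg mult_nonneg_nonneg adj0)
  have form: "w \<bullet> consensus_map E w = (\<Sum>j\<in>UNIV. D j / 2 + P j)"
    unfolding inner_consensus_map[OF sym] D_def P_def by (simp add: power2_eq_square mult_ac)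
  have nonneg: "0 \<le> D j / 2 + P j" for j using D0[of j] P0[of j] by simp
  have "w \<bullet> consensus_map E w \<noteq> 0"
  proof
    assume "w \<bullet> consensus_map E w = 0"
    then have "D j / 2 + P j = 0" for j
      using nonneg unfolding form by (subst (asm) sum_nonneg_eq_0_iff) auto
    then have D: "D j = 0" and P: "P j = 0" for j using D0[of j] P0[of j] by (smt (verit) field_sum_of_halves)+
    have edge: "w $ i $ j = w $ k $ j" if "(k, i) \<in> E" for i j k
    proof -
      have "(\<Sum>k\<in>UNIV. adjacency E i k * (w $ i $ j - w $ k $ j)\<^sup>2) = 0"
        using D[of j] unfolding D_def
        by (subst (asm) sum_nonneg_eq_0_iff) (auto intro!: sum_nonneg mult_nonneg_nonneg adj0)
      then have "adjacency E i k * (w $ i $ j - w $ k $ j)\<^sup>2 = 0"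
        by (subst (asm) sum_nonneg_eq_0_iff) (auto intro!: mult_nonneg_nonneg adj0)
      then show ?thesis using that by (simp add: adjacency_def)
    qed
    have const: "w $ k $ j = w $ i $ j" for i j k
      using conn[of i k] by (induction rule: rtrancl_induct) (simp, metis edge)
    have "w $ i $ j = 0" for i j
    proof -
      obtain k where "k \<noteq> j"
        using card by (metis UNIV_eq_I card_1_singleton_iff insertI1 numeral_le_one_iff One_nat_def singletonI semiring_norm(69))
      then obtain h where h: "(j, h) \<in> E"
        using conn[of j k] by (metis converse_rtranclE)
      have "adjacency E h j * (w $ h $ j)\<^sup>2 = 0"
        using P[of j] unfolding P_def
        by (subst (asm) sum_nonneg_eq_0_iff) (auto intro!: mult_nonneg_nonneg adj0)
      then have "w $ h $ j = 0" using h by (simp add: adjacency_def)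
      then show ?thesis using const by metis
    qed
    then show False using w by (simp add: vec_eq_iff)
  qed
  moreover have "0 \<le> w \<bullet> consensus_map E w" unfolding form by (intro sum_nonneg nonneg)
  ultimately show ?thesis by linarith
qed

text \<open>The constant is the minimum of the form on the compact unit sphere.\<close>

lemma positive_definite_imp_coercive:
  fixes A :: "'a::euclidean_space \<Rightarrow> 'a"
  assumes lin: "bounded_linear A" and pos: "\<And>w. w \<noteq> 0 \<Longrightarrow> 0 < w \<bullet> A w"
  shows "\<exists>\<mu>>0. \<forall>w. \<mu> * (norm w)\<^sup>2 \<le> w \<bullet> A w"
proof -
  obtain b :: 'a where "b \<in> Basis" using nonempty_Basis by blast
  then have "b \<in> sphere 0 1" by simp
  then have ne: "sphere (0::'a) 1 \<noteq> {}" by blast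
  have "continuous_on (sphere 0 1) (\<lambda>w. w \<bullet> A w)"
    by (intro continuous_intros linear_continuous_on[OF lin])
  then obtain v where v: "v \<in> sphere 0 1" and min: "\<And>w. w \<in> sphere 0 1 \<Longrightarrow> v \<bullet> A v \<le> w \<bullet> A w"
    using continuous_attains_inf[OF compact_sphere ne] by blast
  have "v \<noteq> 0" using v by auto
  then have "0 < v \<bullet> A v" by (rule pos)
  moreover have "(v \<bullet> A v) * (norm w)\<^sup>2 \<le> w \<bullet> A w" for w
  proof (cases "w = 0")
    case False
    have "v \<bullet> A v \<le> (w /\<^sub>R norm w) \<bullet> A (w /\<^sub>R norm w)"
      using False by (intro min) simp
    also have "\<dots> = (w \<bullet> A w) / (norm w)\<^sup>2"
      using linear_cmul[OF bounded_linear.linear[OF lin]] by (simp add: power2_eq_square field_simps)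
    finally show ?thesis using False by (simp add: field_simps)
  qed simp
  ultimately show ?thesis by blast
qed

section \<open>The Lyapunov function of the closed loop\<close>

text \<open>The hypotheses of the game in the quantitative form in which the Lyapunov estimate consumes them:
  \<open>\<mu>\<close> is the coercivity constant of the graph, and the Nash property enters as the vanishing of the
  pseudo-gradient.\<close>

locale adaptive_seeking =
  fixes f :: "'n::finite \<Rightarrow> real ^ 'n \<Rightarrow> real" and E :: "('n \<times> 'n) set"
    and \<gamma> :: "'n \<Rightarrow> 'n \<Rightarrow> real" and xs :: "real ^ 'n" and l m \<mu> :: real
  assumes gradient_lipschitz: "l-lipschitz_on UNIV (estimated_gradient f)"
    and m_pos: "0 < m"
    and strongly_monotone: "m * (norm (x - z))\<^sup>2 \<le> (x - z) \<bullet> (pseudo_gradient f x - pseudo_gradient f z)"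
    and sym_E: "sym E"
    and \<mu>_pos: "0 < \<mu>"
    and coercive: "\<mu> * (norm w)\<^sup>2 \<le> w \<bullet> consensus_map E w"
    and \<gamma>_pos: "0 < \<gamma> i j"
    and equilibrium: "pseudo_gradient f xs = 0"
begin

abbreviation act :: "'n state \<Rightarrow> real ^ 'n" where "act z \<equiv> fst z"
abbreviation est :: "'n state \<Rightarrow> real ^ 'n ^ 'n" where "est z \<equiv> fst (snd z)"
abbreviation gain :: "'n state \<Rightarrow> real ^ 'n ^ 'n" where "gain z \<equiv> snd (snd z)"

definition err :: "'n state \<Rightarrow> real ^ 'n ^ 'n" where
  "err z = est z - stacked_copies (act z)"

abbreviation disagreement :: "'n state \<Rightarrow> real ^ 'n ^ 'n" where
  "disagreement z \<equiv> consensus_map E (err z)"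

abbreviation field :: "'n state \<Rightarrow> 'n state" where "field \<equiv> seeking_field f E \<gamma>"

lemma field_components:
  "act (field z) = - estimated_gradient f (est z)"
  "est (field z) = (\<chi> i j. - gain z $ i $ j * disagreement z $ i $ j)"
  "gain (field z) = (\<chi> i j. \<gamma> i j * (disagreement z $ i $ j)\<^sup>2)"
  by (simp_all add: seeking_field_def split_beta consensus_error_eq_consensus_map err_def
      estimated_gradient_def vec_eq_iff)

lemma bounded_linear_err: "bounded_linear err"
  unfolding err_def
  by (intro bounded_linear_sub bounded_linear_compose[OF bounded_linear_fst bounded_linear_snd]
      bounded_linear_compose[OF bounded_linear_stacked_copies bounded_linear_fst])

lemma bounded_linear_disagreement: "bounded_linear disagreement"
  by (rule bounded_linear_compose[OF bounded_linear_consensus_map bounded_linear_err])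

lemma bounded_linear_gain: "bounded_linear gain"
  by (rule bounded_linear_compose[OF bounded_linear_snd bounded_linear_snd])

lemma field_lipschitz_on_balls: "lipschitz_on_balls field"
proof -
  note entry = lipschitz_on_balls_linear[OF bounded_linear_entry]
  have "lipschitz_on_balls (\<lambda>z. - estimated_gradient f (est z))"
    unfolding lipschitz_on_balls_def
  proof
    fix R :: real
    obtain K where "K-lipschitz_on (cball 0 R) (est :: 'n state \<Rightarrow> _)"
      using bounded_linear.lipschitz_boundE[OF bounded_linear_compose[OF bounded_linear_fst bounded_linear_snd]]
      by metis
    then have "(l * K)-lipschitz_on (cball 0 R) (\<lambda>z. estimated_gradient f (est z))"
      by (rule lipschitz_on_compose2) (rule lipschitz_on_subset[OF gradient_lipschitz], simp)
    then show "\<exists>L. L-lipschitz_on (cball 0 R) (\<lambda>z::'n state. - estimated_gradient f (est z))"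
      by (auto simp: lipschitz_on_minus_iff)
  qed
  moreover have "lipschitz_on_balls (\<lambda>z. \<chi> i j. - gain z $ i $ j * disagreement z $ i $ j)"
    by (intro lipschitz_on_balls_vec, simp only: vec_lambda_beta)
       (intro lipschitz_on_balls_mult entry bounded_linear_disagreement
         lipschitz_on_balls_linear bounded_linear_minus bounded_linear_entry bounded_linear_gain)
  moreover have "lipschitz_on_balls (\<lambda>z. \<chi> i j. \<gamma> i j * (disagreement z $ i $ j)\<^sup>2)"
    by (intro lipschitz_on_balls_vec, simp only: vec_lambda_beta power2_eq_square)
       (intro lipschitz_on_balls_mult entry bounded_linear_disagreement lipschitz_on_balls_const)
  ultimately have "lipschitz_on_balls (\<lambda>z. (act (field z), est (field z), gain (field z)))"
    unfolding field_components by (intro lipschitz_on_balls_Pair)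
  then show ?thesis by simp
qed

definition lyapunov :: "real ^ 'n ^ 'n \<Rightarrow> 'n state \<Rightarrow> real" where
  "lyapunov \<theta>s z = ((act z - xs) \<bullet> (act z - xs) + err z \<bullet> disagreement z) / 2
     + (\<Sum>i\<in>UNIV. \<Sum>j\<in>UNIV. (gain z $ i $ j - \<theta>s $ i $ j)\<^sup>2 / (2 * \<gamma> i j))"

definition lyapunov_deriv :: "real ^ 'n ^ 'n \<Rightarrow> 'n state \<Rightarrow> 'n state \<Rightarrow> real" where
  "lyapunov_deriv \<theta>s z h = (act z - xs) \<bullet> act h + err h \<bullet> disagreement z
     + (\<Sum>i\<in>UNIV. \<Sum>j\<in>UNIV. (gain z $ i $ j - \<theta>s $ i $ j) * gain h $ i $ j / \<gamma> i j)"

text \<open>Self-adjointness of \<open>consensus_map\<close> lets the two halves of the product rule for \<open>err z \<bullet> disagreement z\<close>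
  coincide, so that only the derivative of the error itself appears.\<close>

lemma has_derivative_lyapunov: "(lyapunov \<theta>s has_derivative lyapunov_deriv \<theta>s z) (at z)"
proof -
  note lin = bounded_linear_imp_has_derivative
  have 1: "((\<lambda>z. (act z - xs) \<bullet> (act z - xs)) has_derivative (\<lambda>h. 2 * ((act z - xs) \<bullet> act h))) (at z)"
    by (auto intro!: derivative_eq_intros simp: inner_commute)
  have 2: "((\<lambda>z. err z \<bullet> disagreement z) has_derivative (\<lambda>h. 2 * (err h \<bullet> disagreement z))) (at z)"
    by (rule has_derivative_eq_rhs[OF has_derivative_inner[OF lin[OF bounded_linear_err] lin[OF bounded_linear_disagreement]]])
       (simp add: fun_eq_iff consensus_map_self_adjoint[OF sym_E, of "err z"])
  have 3: "((\<lambda>z. (gain z $ i $ j - \<theta>s $ i $ j)\<^sup>2 / (2 * \<gamma> i j)) has_derivative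
      (\<lambda>h. (gain z $ i $ j - \<theta>s $ i $ j) * gain h $ i $ j / \<gamma> i j)) (at z)" for i j
  proof -
    have g: "((\<lambda>z. gain z $ i $ j) has_derivative (\<lambda>h. gain h $ i $ j)) (at z)"
      by (rule lin[OF bounded_linear_entry[OF bounded_linear_gain]])
    show ?thesis
      by (rule has_derivative_eq_rhs, (rule derivative_intros g)+)
         (use \<gamma>_pos[of i j] in \<open>auto simp: fun_eq_iff power2_eq_square field_simps\<close>)
  qed
  show ?thesis
    unfolding lyapunov_def[abs_def]
    by (rule has_derivative_eq_rhs[OF has_derivative_add[OF
          bounded_linear.has_derivative[OF bounded_linear_divide has_derivative_add[OF 1 2]]
          has_derivative_sum[OF has_derivative_sum[OF 3]]]])
       (simp add: fun_eq_iff lyapunov_deriv_def)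
qed

text \<open>The key cancellation. The error dynamics produce \<open>- gain * disagreement\<^sup>2\<close>, the gain dynamics produce
  \<open>(gain - \<theta>s) * disagreement\<^sup>2\<close>; in the sum only the reference gains \<open>\<theta>s\<close> survive. The middle term is the
  drift of the actions as seen by the estimation error.\<close>

lemma lyapunov_deriv_field:
  "lyapunov_deriv \<theta>s z (field z) = - ((act z - xs) \<bullet> estimated_gradient f (est z))
     + stacked_copies (estimated_gradient f (est z)) \<bullet> disagreement z
     - (\<Sum>i\<in>UNIV. \<Sum>j\<in>UNIV. \<theta>s $ i $ j * (disagreement z $ i $ j)\<^sup>2)"
proof -
  define g where "g = estimated_gradient f (est z)"
  define e where "e = disagreement z"
  have "err (field z) = (\<chi> i j. - gain z $ i $ j * e $ i $ j) + stacked_copies g"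
    using linear_neg[OF bounded_linear.linear[OF bounded_linear_stacked_copies], of g]
    by (simp add: err_def field_components g_def e_def)
  moreover have "(\<chi> i j. - gain z $ i $ j * e $ i $ j) \<bullet> e
      = - (\<Sum>i\<in>UNIV. \<Sum>j\<in>UNIV. gain z $ i $ j * (e $ i $ j)\<^sup>2)"
    by (simp add: inner_vec_def sum_negf power2_eq_square mult.assoc)
  moreover have "(\<Sum>i\<in>UNIV. \<Sum>j\<in>UNIV. (gain z $ i $ j - \<theta>s $ i $ j) * gain (field z) $ i $ j / \<gamma> i j)
      = (\<Sum>i\<in>UNIV. \<Sum>j\<in>UNIV. gain z $ i $ j * (e $ i $ j)\<^sup>2)
        - (\<Sum>i\<in>UNIV. \<Sum>j\<in>UNIV. \<theta>s $ i $ j * (e $ i $ j)\<^sup>2)"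
    unfolding sum_subtractf[symmetric]
    using less_imp_neq[OF \<gamma>_pos, symmetric]
    by (intro sum.cong refl) (simp add: field_components e_def left_diff_distrib diff_divide_distrib)
  ultimately show ?thesis
    unfolding lyapunov_deriv_def g_def[symmetric] e_def[symmetric]
    by (simp add: field_components inner_add_left g_def)
qed

text \<open>With \<open>N\<close> players and \<open>a = l / \<mu> + N\<^sup>2 l\<close> the coefficient of the cross term \<open>norm (x - xs) * norm (M w)\<close>, the first summand
  pays for that cross term by completing the square, the second for the direct \<open>(norm (M w))\<^sup>2\<close>
  term, and the last leaves a unit rate of dissipation.\<close>

definition gain_threshold :: real where
  "gain_threshold = (l / \<mu> + (real CARD('n))\<^sup>2 * l)\<^sup>2 / (2 * m) + real CARD('n) * l / \<mu> + 1"

lemma norm_err_le: "norm (err z) \<le> norm (disagreement z) / \<mu>"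
proof (cases "err z = 0")
  case False
  have "\<mu> * (norm (err z))\<^sup>2 \<le> norm (err z) * norm (disagreement z)"
    using coercive[of "err z"] norm_cauchy_schwarz[of "err z" "disagreement z"] by linarith
  then have "\<mu> * norm (err z) \<le> norm (disagreement z)"
    using False by (simp add: power2_eq_square)
  then show ?thesis using \<mu>_pos by (simp add: field_simps)
qed (use \<mu>_pos in simp)

text \<open>In the proof \<open>p\<close>, \<open>q\<close>, \<open>r\<close> are the norms of the action error, the disagreement and the estimation error.
  Replacing the true pseudo-gradient by the one evaluated at the estimates costs \<open>l * r\<close>, and \<open>r \<le> q / \<mu>\<close>;
  all terms then become quadratic in \<open>p\<close> and \<open>q\<close>.\<close>

lemma lyapunov_deriv_field_le:
  assumes large: "\<And>i j. gain_threshold \<le> \<theta>s $ i $ j"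
  shows "lyapunov_deriv \<theta>s z (field z) \<le> - (m / 2) * (norm (act z - xs))\<^sup>2 - (norm (disagreement z))\<^sup>2"
proof -
  define N where "N = real CARD('n)"
  define g where "g = estimated_gradient f (est z)"
  define e where "e = disagreement z"
  define p q r where "p = norm (act z - xs)" and "q = norm e" and "r = norm (err z)"
  have N0: "0 \<le> N" and p0: "0 \<le> p" and q0: "0 \<le> q" by (simp_all add: N_def p_def q_def)
  have l0: "0 \<le> l" using gradient_lipschitz by (rule lipschitz_on_nonneg)
  have r: "r \<le> q / \<mu>" using norm_err_le by (simp add: r_def q_def e_def)
  have glip: "norm (estimated_gradient f y - estimated_gradient f v) \<le> l * norm (y - v)" for y v
    using lipschitz_on_normD[OF gradient_lipschitz] by simp
  have g_P: "norm (g - pseudo_gradient f (act z)) \<le> l * r"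
    using glip[of "est z" "stacked_copies (act z)"]
    by (simp add: g_def r_def err_def estimated_gradient_stacked_copies)
  have "norm (pseudo_gradient f (act z)) \<le> l * norm (stacked_copies (act z - xs))"
    using glip[of "stacked_copies (act z)" "stacked_copies xs"] equilibrium
      linear_diff[OF bounded_linear.linear[OF bounded_linear_stacked_copies], of "act z" xs]
    by (simp add: estimated_gradient_stacked_copies)
  also have "\<dots> \<le> l * (N * p)"
    using norm_stacked_copies_le[of "act z - xs"] l0 by (intro mult_left_mono) (auto simp: N_def p_def)
  finally have g_norm: "norm g \<le> l * r + l * (N * p)"
    using g_P norm_triangle_sub[of g "pseudo_gradient f (act z)"] by linarith
  \<comment> \<open>Gradient play: strong monotonicity at the true actions, plus the error made by using estimates.\<close>
  have term1: "- ((act z - xs) \<bullet> g) \<le> - m * p\<^sup>2 + p * (l * r)"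
  proof -
    have "- ((act z - xs) \<bullet> (g - pseudo_gradient f (act z))) \<le> p * (l * r)"
      using Cauchy_Schwarz_ineq2[of "act z - xs" "g - pseudo_gradient f (act z)"]
        mult_left_mono[OF g_P p0] unfolding p_def by linarith
    moreover have "m * p\<^sup>2 \<le> (act z - xs) \<bullet> pseudo_gradient f (act z)"
      using strongly_monotone[of "act z" xs] equilibrium by (simp add: p_def)
    ultimately show ?thesis by (simp add: inner_diff_right)
  qed
  \<comment> \<open>Motion of the actions, which the estimates have to track.\<close>
  have term2: "stacked_copies g \<bullet> e \<le> N * (l * r + l * (N * p)) * q"
  proof -
    have "stacked_copies g \<bullet> e \<le> norm (stacked_copies g) * q"
      unfolding q_def by (rule norm_cauchy_schwarz)
    also have "\<dots> \<le> N * norm g * q"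
      using norm_stacked_copies_le[of g] q0 by (intro mult_right_mono) (auto simp: N_def)
    also have "\<dots> \<le> N * (l * r + l * (N * p)) * q"
      using g_norm N0 q0 by (intro mult_right_mono mult_left_mono) auto
    finally show ?thesis .
  qed
  have term3: "gain_threshold * q\<^sup>2 \<le> (\<Sum>i\<in>UNIV. \<Sum>j\<in>UNIV. \<theta>s $ i $ j * (e $ i $ j)\<^sup>2)"
    unfolding q_def norm_matrix_power2 sum_distrib_left
    by (intro sum_mono mult_right_mono large) simp
  define a where "a = l / \<mu> + N\<^sup>2 * l"
  have "p * (l * r) \<le> p * (l * (q / \<mu>))" using r p0 l0 by (intro mult_left_mono) auto
  moreover have "N * (l * r + l * (N * p)) * q \<le> N * (l * (q / \<mu>) + l * (N * p)) * q"
    using r l0 N0 q0 by (intro mult_right_mono mult_left_mono add_right_mono) auto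
  moreover have "p * (l * (q / \<mu>)) + N * (l * (q / \<mu>) + l * (N * p)) * q = a * p * q + N * l / \<mu> * q\<^sup>2"
    by (simp add: a_def algebra_simps power2_eq_square add_divide_distrib)
  moreover have "a * p * q \<le> m / 2 * p\<^sup>2 + a\<^sup>2 / (2 * m) * q\<^sup>2"
  proof -
    \<comment> \<open>Half of the strong monotonicity is spent on the cross term, half is kept.\<close>
    have "m / 2 * p\<^sup>2 + a\<^sup>2 / (2 * m) * q\<^sup>2 - a * p * q = (m * p - a * q)\<^sup>2 / (2 * m)"
      using m_pos by (simp add: field_simps power2_eq_square)
    moreover have "0 \<le> (m * p - a * q)\<^sup>2 / (2 * m)" using m_pos by simp
    ultimately show ?thesis by linarith
  qed
  moreover have "gain_threshold * q\<^sup>2 = a\<^sup>2 / (2 * m) * q\<^sup>2 + N * l / \<mu> * q\<^sup>2 + q\<^sup>2"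
    by (simp add: gain_threshold_def a_def N_def distrib_right)
  ultimately have "lyapunov_deriv \<theta>s z (field z) \<le> - m * p\<^sup>2 + m / 2 * p\<^sup>2 - q\<^sup>2"
    using term1 term2 term3 unfolding lyapunov_deriv_field g_def e_def by linarith
  then show ?thesis by (simp add: p_def q_def e_def field_simps)
qed

lemma lyapunov_deriv_field_nonpos:
  assumes "\<And>i j. gain_threshold \<le> \<theta>s $ i $ j"
  shows "lyapunov_deriv \<theta>s z (field z) \<le> 0"
proof -
  have "0 \<le> m / 2 * (norm (act z - xs))\<^sup>2" using m_pos by simp
  then show ?thesis using lyapunov_deriv_field_le[OF assms, of z] zero_le_power2[of "norm (disagreement z)"] by linarith
qed

text \<open>\<open>V\<close> dominates the squared distance to the equilibrium with gains \<open>\<theta>s\<close>, with a constant independent of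
  \<open>\<theta>s\<close>. The estimates need the detour \<open>y - stacked_copies xs = w + stacked_copies (x - xs)\<close> because \<open>V\<close> measures
  their error relative to the moving actions.\<close>

lemma dist_power2_le_lyapunov:
  "\<exists>C>0. \<forall>z \<theta>s. (dist z (xs, stacked_copies xs, \<theta>s))\<^sup>2 \<le> C * lyapunov \<theta>s z"
proof -
  define N where "N = real CARD('n)"
  define \<Gamma> where "\<Gamma> = (\<Sum>i\<in>UNIV. \<Sum>j\<in>UNIV. \<gamma> i j)"
  have \<Gamma>: "\<gamma> i j \<le> \<Gamma>" for i j
  proof -
    have "\<gamma> i j \<le> (\<Sum>j\<in>UNIV. \<gamma> i j)"
      by (rule member_le_sum) (auto intro: less_imp_le \<gamma>_pos)
    also have "\<dots> \<le> \<Gamma>" unfolding \<Gamma>_def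
      by (rule member_le_sum) (auto intro!: sum_nonneg less_imp_le[OF \<gamma>_pos])
    finally show ?thesis .
  qed
  have \<Gamma>0: "0 < \<Gamma>" using \<Gamma> \<gamma>_pos less_le_trans by blast
  define C where "C = 2 * (1 + 2 * N\<^sup>2) + 4 / \<mu> + 2 * \<Gamma>"
  have "0 < C"
    unfolding C_def using \<Gamma>0 \<mu>_pos by (intro add_pos_pos mult_pos_pos add_pos_nonneg) auto
  moreover have "(dist z (xs, stacked_copies xs, \<theta>s))\<^sup>2 \<le> C * lyapunov \<theta>s z" for z \<theta>s
  proof -
    define p r s v where "p = norm (act z - xs)" and "r = norm (err z)" and "s = norm (gain z - \<theta>s)"
      and "v = norm (est z - stacked_copies xs)"
    define T where "T = (\<Sum>i\<in>UNIV. \<Sum>j\<in>UNIV. (gain z $ i $ j - \<theta>s $ i $ j)\<^sup>2 / (2 * \<gamma> i j))"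
    define V where "V = lyapunov \<theta>s z"
    have "x\<^sup>2 / (2 * \<Gamma>) \<le> x\<^sup>2 / (2 * \<gamma> i j)" for x i j
      using \<Gamma>[of i j] \<gamma>_pos[of i j] \<Gamma>0 by (intro divide_left_mono mult_pos_pos) simp_all
    then have T: "s\<^sup>2 / (2 * \<Gamma>) \<le> T"
      unfolding s_def norm_matrix_power2 T_def sum_divide_distrib by (intro sum_mono) simp
    have W: "\<mu> * r\<^sup>2 \<le> err z \<bullet> disagreement z" unfolding r_def by (rule coercive)
    have V: "V = p\<^sup>2 / 2 + (err z \<bullet> disagreement z) / 2 + T"
      by (simp add: V_def lyapunov_def T_def p_def power2_norm_eq_inner add_divide_distrib)
    have T0: "0 \<le> s\<^sup>2 / (2 * \<Gamma>)" using \<Gamma>0 by simp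
    have W0: "0 \<le> \<mu> * r\<^sup>2" using \<mu>_pos by simp
    have p: "p\<^sup>2 \<le> 2 * V" using V T T0 W W0 by linarith
    have "\<mu> * r\<^sup>2 \<le> 2 * V" using V T T0 W zero_le_power2[of p] by linarith
    then have r: "r\<^sup>2 \<le> 2 / \<mu> * V" using \<mu>_pos by (simp add: field_simps)
    have "s\<^sup>2 / (2 * \<Gamma>) \<le> V" using V T W W0 zero_le_power2[of p] by linarith
    then have s: "s\<^sup>2 \<le> 2 * \<Gamma> * V" using \<Gamma>0 by (simp add: field_simps)
    have "est z - stacked_copies xs = err z + stacked_copies (act z - xs)"
      using linear_diff[OF bounded_linear.linear[OF bounded_linear_stacked_copies], of "act z" xs]
      by (simp add: err_def)
    then have "v \<le> r + N * p"
      unfolding v_def r_def p_def N_def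
      using norm_triangle_ineq[of "err z" "stacked_copies (act z - xs)"] norm_stacked_copies_le[of "act z - xs"]
      by simp
    then have "v\<^sup>2 \<le> (r + N * p)\<^sup>2" by (rule power_mono) (simp add: v_def)
    also have "\<dots> \<le> 2 * r\<^sup>2 + 2 * N\<^sup>2 * p\<^sup>2"
      using zero_le_power2[of "r - N * p"] by (simp add: power2_eq_square algebra_simps)
    finally have v: "v\<^sup>2 \<le> 2 * r\<^sup>2 + 2 * N\<^sup>2 * p\<^sup>2" .
    have "N\<^sup>2 * p\<^sup>2 \<le> N\<^sup>2 * (2 * V)" using p by (intro mult_left_mono) auto
    have "(dist z (xs, stacked_copies xs, \<theta>s))\<^sup>2 = p\<^sup>2 + v\<^sup>2 + s\<^sup>2"
      by (cases z) (simp add: dist_norm norm_Pair p_def v_def s_def)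
    also have "\<dots> \<le> 2 * V + (2 * (2 / \<mu> * V) + 2 * (N\<^sup>2 * (2 * V))) + 2 * \<Gamma> * V"
      using p r s v \<open>N\<^sup>2 * p\<^sup>2 \<le> N\<^sup>2 * (2 * V)\<close> by linarith
    also have "\<dots> = C * V" by (simp add: C_def algebra_simps)
    finally show ?thesis by (simp add: V_def)
  qed
  ultimately show ?thesis by blast
qed

lemma lyapunov_nonneg: "0 \<le> lyapunov \<theta>s z"
proof -
  obtain C where C: "C > 0" "(dist z (xs, stacked_copies xs, \<theta>s))\<^sup>2 \<le> C * lyapunov \<theta>s z"
    using dist_power2_le_lyapunov by blast
  then have "0 \<le> C * lyapunov \<theta>s z" using zero_le_power2 order_trans by blast
  then show ?thesis using C(1) by (simp add: zero_le_mult_iff)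
qed

lemma bounded_lyapunov_sublevel: "bounded {z. lyapunov \<theta>s z \<le> c}"
proof -
  obtain C where C: "C > 0" "\<And>z. (dist z (xs, stacked_copies xs, \<theta>s))\<^sup>2 \<le> C * lyapunov \<theta>s z"
    using dist_power2_le_lyapunov by blast
  have "dist (xs, stacked_copies xs, \<theta>s) z \<le> sqrt (C * c)" if "lyapunov \<theta>s z \<le> c" for z
    using order_trans[OF C(2)[of z] mult_left_mono[OF that, of C]] C(1)
    by (intro real_le_rsqrt) (simp add: dist_commute)
  then show ?thesis unfolding bounded_def by blast
qed

lemma lyapunov_solution_le:
  assumes "\<And>i j. gain_threshold \<le> \<theta>s $ i $ j" and "ode_solution field z" and "0 \<le> t"
  shows "lyapunov \<theta>s (z t) \<le> lyapunov \<theta>s (z 0)"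
  by (rule lyapunov_function_nonincreasing[OF has_derivative_lyapunov assms(2)
        lyapunov_deriv_field_nonpos[OF assms(1)] order_refl assms(3)])

section \<open>Stability and convergence of the closed loop\<close>

text \<open>Using the equilibrium's own gains as reference, \<open>V\<close> is continuous, zero at the equilibrium, nonincreasing
  along solutions, and up to a constant factor an upper bound for the squared distance to it.\<close>

theorem large_gain_equilibria_stable:
  assumes large: "\<And>i j. gain_threshold \<le> \<theta>s $ i $ j"
  shows "stable_equilibrium_point field (xs, stacked_copies xs, \<theta>s)"
proof -
  define P where "P = (xs, stacked_copies xs, \<theta>s)"
  have err: "err P = 0" by (simp add: err_def P_def)
  have dis: "disagreement P = 0"
    using linear_0[OF bounded_linear.linear[OF bounded_linear_consensus_map]] by (simp add: err)
  have "field P = (act (field P), est (field P), gain (field P))" by simp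
  also have "\<dots> = 0"
    unfolding field_components dis
    using equilibrium by (simp add: P_def estimated_gradient_stacked_copies zero_prod_def vec_eq_iff)
  finally have "field P = 0" .
  moreover have "\<exists>\<delta>>0. \<forall>z. ode_solution field z \<and> dist (z 0) P < \<delta> \<longrightarrow> (\<forall>t\<ge>0. dist (z t) P < \<epsilon>)"
    if \<epsilon>: "0 < \<epsilon>" for \<epsilon>
  proof -
    obtain C where C: "C > 0" "\<And>z. (dist z P)\<^sup>2 \<le> C * lyapunov \<theta>s z"
      using dist_power2_le_lyapunov unfolding P_def by blast
    have "lyapunov \<theta>s P = 0" by (simp add: lyapunov_def err) (simp add: P_def)
    moreover have "isCont (lyapunov \<theta>s) P"
      by (rule has_derivative_continuous[OF has_derivative_lyapunov])
    moreover have "0 < \<epsilon>\<^sup>2 / C" using \<epsilon> C by simp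
    ultimately obtain \<delta> where \<delta>: "0 < \<delta>" "\<And>z. dist z P < \<delta> \<Longrightarrow> dist (lyapunov \<theta>s z) 0 < \<epsilon>\<^sup>2 / C"
      unfolding continuous_at_eps_delta by metis
    have "dist (z t) P < \<epsilon>" if z: "ode_solution field z" "dist (z 0) P < \<delta>" and t: "0 \<le> t" for z t
    proof -
      have "lyapunov \<theta>s (z 0) < \<epsilon>\<^sup>2 / C" using \<delta>(2)[OF z(2)] by (simp add: dist_real_def)
      then have "C * lyapunov \<theta>s (z t) < \<epsilon>\<^sup>2"
        using lyapunov_solution_le[OF large z(1) t] C(1) by (simp add: field_simps) (smt (verit) mult_left_mono)
      then have "(dist (z t) P)\<^sup>2 < \<epsilon>\<^sup>2" using C(2)[of "z t"] by linarith
      then show ?thesis using \<epsilon> by (simp add: power_less_imp_less_base)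
    qed
    then show ?thesis using \<delta>(1) by blast
  qed
  ultimately show ?thesis unfolding stable_equilibrium_point_def P_def by blast
qed

definition threshold_gains :: "real ^ 'n ^ 'n" where "threshold_gains = (\<chi> i j. gain_threshold)"

lemma threshold_gains_large: "gain_threshold \<le> threshold_gains $ i $ j"
  by (simp add: threshold_gains_def)

theorem solution_exists: "\<exists>z. z 0 = z0 \<and> ode_solution field z"
  by (rule lyapunov_imp_global_solution[OF field_lipschitz_on_balls has_derivative_lyapunov
        lyapunov_deriv_field_nonpos[OF threshold_gains_large] bounded_lyapunov_sublevel])

context
  fixes z :: "real \<Rightarrow> 'n state"
  assumes sol: "ode_solution field z"
begin

lemma bounded_solution: "bounded (z ` {0..})"
  by (rule bounded_subset[OF bounded_lyapunov_sublevel[of threshold_gains "lyapunov threshold_gains (z 0)"]])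
     (auto intro: lyapunov_solution_le[OF threshold_gains_large sol])

text \<open>A trajectory stays in a sublevel set, so its velocity is bounded and every affine image of it is Lipschitz
  in time: what Barbalat's argument needs for a dissipated quantity \<open>norm (T z - b)\<close>.\<close>

lemma solution_residual_tendsto_zero:
  assumes T: "bounded_linear T" and c: "0 < c"
    and dissipation: "\<And>w. lyapunov_deriv threshold_gains w (field w) \<le> - c * (norm (T w - b))\<^sup>2"
  shows "((\<lambda>t. norm (T (z t) - b)) \<longlongrightarrow> 0) at_top"
proof -
  obtain C where C: "C-lipschitz_on {0..} z"
    using bounded_solution_lipschitz[OF field_lipschitz_on_balls sol bounded_solution] by blast
  obtain K where K: "K-lipschitz_on UNIV T"
    using bounded_linear.lipschitz_boundE[OF T] by metis
  have "1-lipschitz_on UNIV (\<lambda>v. norm (v - b))"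
  proof (rule lipschitz_onI)
    show "dist (norm (v - b)) (norm (w - b)) \<le> 1 * dist v w" for v w
      using norm_triangle_ineq3[of "v - b" "w - b"] by (simp add: dist_norm)
  qed simp
  then have "(1 * (K * C))-lipschitz_on {0..} (\<lambda>t. norm (T (z t) - b))"
    by (intro lipschitz_on_compose2[of _ _ "\<lambda>t. T (z t)"] lipschitz_on_compose2[OF C])
       (auto intro: lipschitz_on_subset K)
  then show ?thesis
    using barbalat[OF derivative_along_solution[OF has_derivative_lyapunov sol] dissipation c lyapunov_nonneg] by blast
qed

theorem actions_converge: "((\<lambda>t. act (z t)) \<longlongrightarrow> xs) at_top"
proof -
  have "((\<lambda>t. norm (act (z t) - xs)) \<longlongrightarrow> 0) at_top"
  proof (rule solution_residual_tendsto_zero[OF bounded_linear_fst])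
    show "lyapunov_deriv threshold_gains w (field w) \<le> - (m / 2) * (norm (act w - xs))\<^sup>2" for w
      using lyapunov_deriv_field_le[OF threshold_gains_large, of w] zero_le_power2[of "norm (disagreement w)"]
      by linarith
  qed (use m_pos in simp)
  then show ?thesis by (rule LIM_zero_cancel[OF tendsto_norm_zero_cancel])
qed

theorem estimates_converge: "((\<lambda>t. norm (err (z t))) \<longlongrightarrow> 0) at_top"
proof -
  have "((\<lambda>t. norm (disagreement (z t) - 0)) \<longlongrightarrow> 0) at_top"
  proof (rule solution_residual_tendsto_zero[OF bounded_linear_disagreement zero_less_one])
    show "lyapunov_deriv threshold_gains w (field w) \<le> - 1 * (norm (disagreement w - 0))\<^sup>2" for w
    proof -
      have "0 \<le> m / 2 * (norm (act w - xs))\<^sup>2" using m_pos by simp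
      then show ?thesis using lyapunov_deriv_field_le[OF threshold_gains_large, of w] by simp
    qed
  qed
  then have "((\<lambda>t. norm (disagreement (z t)) / \<mu>) \<longlongrightarrow> 0) at_top"
    by (simp add: tendsto_divide_zero)
  then show ?thesis
    by (rule Lim_null_comparison[rotated]) (simp add: norm_err_le)
qed

text \<open>The negative of a gain is itself nonincreasing along solutions from any state, so it can be treated like a
  Lyapunov function; boundedness comes from the trajectory.\<close>

theorem gains_converge: "\<exists>c. ((\<lambda>t. gain (z t) $ i $ j) \<longlongrightarrow> c) at_top"
proof (rule bounded_nondecreasing_converges)
  fix s t :: real assume st: "0 \<le> s" "s \<le> t"
  have lin: "bounded_linear (\<lambda>w::'n state. - gain w $ i $ j)"
    by (intro bounded_linear_minus bounded_linear_entry bounded_linear_gain)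
  have "- gain (z t) $ i $ j \<le> - gain (z s) $ i $ j"
    by (rule lyapunov_function_nonincreasing[OF bounded_linear_imp_has_derivative[OF lin] sol _ st])
       (simp add: field_components less_imp_le[OF \<gamma>_pos])
  then show "gain (z s) $ i $ j \<le> gain (z t) $ i $ j" by simp
next
  have "bounded ((\<lambda>w. gain w $ i $ j) ` (z ` {0..}))"
    by (rule bounded_linear_image[OF bounded_solution bounded_linear_entry[OF bounded_linear_gain]])
  then show "bdd_above ((\<lambda>t. gain (z t) $ i $ j) ` {0..})"
    by (simp add: image_image bounded_imp_bdd_above)
qed

end

end

section \<open>Adaptive Nash equilibrium seeking\<close>

theorem theorem1:
  fixes f :: "'n::finite \<Rightarrow> real ^ 'n \<Rightarrow> real"
    and E :: "('n \<times> 'n) set"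
    and \<gamma> :: "'n \<Rightarrow> 'n \<Rightarrow> real"
    and xs :: "real ^ 'n"
  assumes "CARD('n) \<ge> 2"
    and "\<forall>i. twice_continuously_differentiable (f i)"
    and "\<forall>i. \<exists>l>0. \<forall>x z. norm (partial_deriv i (f i) x - partial_deriv i (f i) z) \<le> l * norm (x - z)"
    and "\<exists>m>0. \<forall>x z. (x - z) \<bullet> (pseudo_gradient f x - pseudo_gradient f z) \<ge> m * (norm (x - z))\<^sup>2"
    and "undirected_connected_graph E"
    and "\<forall>i j. \<gamma> i j > 0"
    and "nash_equilibrium f xs"
  shows "actions_globally_asymptotically_stable (seeking_field f E \<gamma>) xs \<and>
    (\<forall>x y \<theta>. ode_solution (seeking_field f E \<gamma>) (\<lambda>t. (x t, y t, \<theta> t)) \<longrightarrow>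
       ((\<lambda>t. norm (y t - stacked_copies (x t))) \<longlongrightarrow> 0) at_top \<and>
       (\<forall>i j. \<exists>c. ((\<lambda>t. \<theta> t $ i $ j) \<longlongrightarrow> c) at_top))"
proof -
  obtain l where l: "\<And>i. 0 < l i"
      "\<And>i x z. \<bar>partial_deriv i (f i) x - partial_deriv i (f i) z\<bar> \<le> l i * norm (x - z)"
    using assms(3) unfolding real_norm_def by metis
  obtain m where m: "0 < m"
      "\<And>x z. m * (norm (x - z))\<^sup>2 \<le> (x - z) \<bullet> (pseudo_gradient f x - pseudo_gradient f z)"
    using assms(4) by blast
  obtain \<mu> where \<mu>: "0 < \<mu>" "\<And>w. \<mu> * (norm w)\<^sup>2 \<le> w \<bullet> consensus_map E w"
    using positive_definite_imp_coercive[OF bounded_linear_consensus_map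
        consensus_map_positive_definite[OF assms(1,5)]] by blast
  have diff: "f i differentiable (at xs)" for i
    using assms(2) unfolding twice_continuously_differentiable_def differentiable_def by blast
  interpret adaptive_seeking f E \<gamma> xs "\<Sum>i\<in>UNIV. l i" m \<mu>
  proof
    show "(\<Sum>i\<in>UNIV. l i)-lipschitz_on UNIV (estimated_gradient f)"
      by (rule estimated_gradient_lipschitz) (use l in \<open>auto intro: less_imp_le\<close>)
    show "sym E" using assms(5) by (simp add: undirected_connected_graph_def)
    show "pseudo_gradient f xs = 0"
      by (rule nash_equilibrium_pseudo_gradient_zero[OF diff assms(7)])
  qed (use m \<mu> assms(6) in blast)+
  show ?thesis
  proof (intro conjI allI impI)
    show "actions_globally_asymptotically_stable field xs"
      unfolding actions_globally_asymptotically_stable_def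
      using large_gain_equilibria_stable solution_exists actions_converge by blast
  next
    fix x y \<theta> assume sol: "ode_solution field (\<lambda>t. (x t, y t, \<theta> t))"
    show "((\<lambda>t. norm (y t - stacked_copies (x t))) \<longlongrightarrow> 0) at_top"
      using estimates_converge[OF sol] by (simp add: err_def)
    show "\<exists>c. ((\<lambda>t. \<theta> t $ i $ j) \<longlongrightarrow> c) at_top" for i j
      using gains_converge[OF sol] by simp
  qed
qed

end
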